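(* For every integer $n\ge 1$, $$\sum_{k=0}^n(-1)^k\, b_k\,C_k\binom{n+k}{n-k}^2=0,$$ where $b_k$ denotes the number of complete non-ambiguous trees with $k$ internal vertices and $C_k=\frac{1}{k+1}\binom{2k}{k}$ is the $k$-th Catalan number.
   Context: $\mathbb{N}=\{0,1,2,\dots\}$. For a point $p\in\mathbb{N}\times\mathbb{N}$ write $p=(X(p),Y(p))$. A row is a set of points with fixed $X$, a column a set of points with fixed $Y$. A non-ambiguous tree of size $n$ is a set $A$ of $n$ points of $\mathbb{N}\times\mathbb{N}$ such that: (1) $(0,0)\in A$ (the root); (2) for each non-root $p\in A$, exactly one of the following holds: there is $q\in A$ with $X(q)=X(p)$, $Y(q)<Y(p)$; there is $r\in A$ with $Y(r)=Y(p)$, $X(r)<X(p)$; (3) if some $p\in A$ has $X(p)=x$ (resp. $Y(p)=y$), then for every $0\le x'<x$ (resp. $0\le y'<y$) some $q\in A$ has $X(q)=x'$ (resp. $Y(q)=y'$). $A$ has a binary tree structure with root $(0,0)$: the parent of a non-root $p$ is the nearest point of $A$ preceding $p$ in its row (then $p$ is a right child) or in its column (then $p$ is a left child). A non-ambiguous tree is complete if each of its vertices has either $0$ or $2$ children; vertices with $2$ children are internal. *)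

theory Defs
  imports Complex_Main
begin

text \<open>A point \<open>p\<close> of the grid has coordinates \<open>X(p) = fst p\<close> and \<open>Y(p) = snd p\<close>; points of a row
  share \<open>fst\<close>, points of a column share \<open>snd\<close>. The size of a tree is its cardinality.\<close>

definition non_ambiguous_tree :: "(nat \<times> nat) set \<Rightarrow> bool" where
  "non_ambiguous_tree A \<longleftrightarrow>
     finite A \<and>
     (0, 0) \<in> A \<and>
     (\<forall>p\<in>A. p \<noteq> (0, 0) \<longrightarrow>
        (\<exists>q\<in>A. fst q = fst p \<and> snd q < snd p) \<noteq> (\<exists>r\<in>A. snd r = snd p \<and> fst r < fst p)) \<and>
     (\<forall>p\<in>A. (\<forall>x'<fst p. \<exists>q\<in>A. fst q = x') \<and> (\<forall>y'<snd p. \<exists>q\<in>A. snd q = y'))"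

text \<open>In the next two definitions, \<open>p\<close> is the point of \<open>A\<close> that precedes \<open>c\<close> most closely in the row,
  respectively the column, of \<open>c\<close>. The root has no preceding point, so it is never a child.\<close>

definition right_child :: "(nat \<times> nat) set \<Rightarrow> nat \<times> nat \<Rightarrow> nat \<times> nat \<Rightarrow> bool" where
  "right_child A p c \<longleftrightarrow> p \<in> A \<and> c \<in> A \<and> fst p = fst c \<and> snd p < snd c \<and>
     (\<forall>q\<in>A. fst q = fst c \<and> snd q < snd c \<longrightarrow> snd q \<le> snd p)"

definition left_child :: "(nat \<times> nat) set \<Rightarrow> nat \<times> nat \<Rightarrow> nat \<times> nat \<Rightarrow> bool" where
  "left_child A p c \<longleftrightarrow> p \<in> A \<and> c \<in> A \<and> snd p = snd c \<and> fst p < fst c \<and>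
     (\<forall>q\<in>A. snd q = snd c \<and> fst q < fst c \<longrightarrow> fst q \<le> fst p)"

definition children :: "(nat \<times> nat) set \<Rightarrow> nat \<times> nat \<Rightarrow> (nat \<times> nat) set" where
  "children A p = {c. left_child A p c \<or> right_child A p c}"

definition complete_non_ambiguous_tree :: "(nat \<times> nat) set \<Rightarrow> bool" where
  "complete_non_ambiguous_tree A \<longleftrightarrow>
     non_ambiguous_tree A \<and> (\<forall>p\<in>A. card (children A p) \<in> {0, 2})"

definition internal_vertices :: "(nat \<times> nat) set \<Rightarrow> (nat \<times> nat) set" where
  "internal_vertices A = {p \<in> A. card (children A p) = 2}"

text \<open>A complete tree with \<open>k\<close> internal vertices has \<open>2 * k + 1\<close> points, so by the absence of empty
  rows and columns there are only finitely many of them and \<open>card\<close> is the true count.\<close>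

definition num_complete_nat :: "nat \<Rightarrow> nat" where
  "num_complete_nat k =
     card {A. complete_non_ambiguous_tree A \<and> card (internal_vertices A) = k}"

definition catalan :: "nat \<Rightarrow> rat" where
  "catalan k = 1 / (of_nat k + 1) * of_nat ((2 * k) choose k)"

end

theory Submission
  imports Defs "HOL-Library.Infinite_Set" "HOL-Computational_Algebra.Formal_Power_Series"
begin

text \<open>Cutting a complete tree at its root gives two smaller complete trees that use complementary sets
  of rows and of columns, whence
  \<open>b\<^sub>n\<^sub>+\<^sub>1 = (\<Sum>u\<le>n. (n+1 choose u+1) (n+1 choose u) b\<^sub>u b\<^sub>n\<^sub>-\<^sub>u)\<close>. So \<open>F = (\<Sum>k. b\<^sub>k x\<^sup>k / (k! (k+1)!))\<close> solves
  the Riccati equation \<open>(x F)' = 1 + x F\<^sup>2\<close>, which yields \<open>F = - J' / J\<close> for the Bessel series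
  \<open>J = (\<Sum>j. (-x)\<^sup>j / j!\<^sup>2)\<close>. Comparing coefficients in \<open>J F = - J'\<close> gives, for every \<open>m\<close>, the linear relation
  \<open>(\<Sum>k\<le>m. (-1)\<^sup>k b\<^sub>k / (k! (k+1)! (m-k)!\<^sup>2)) = 1 / (m! (m+1)!)\<close>. The claim is the combination of these
  relations with weights \<open>(-1)\<^sup>m (n+m)! / (n-m)!\<close>: on both sides the sum over \<open>m\<close> is an iterated
  finite difference of binomial coefficients.\<close>

section \<open>Complete trees on arbitrary sets of rows and columns\<close>

definition row_pred :: "(nat \<times> nat) set \<Rightarrow> nat \<Rightarrow> nat \<Rightarrow> bool" where
  "row_pred A x y \<longleftrightarrow> (\<exists>y'<y. (x, y') \<in> A)"

definition col_pred :: "(nat \<times> nat) set \<Rightarrow> nat \<Rightarrow> nat \<Rightarrow> bool" where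
  "col_pred A x y \<longleftrightarrow> (\<exists>x'<x. (x', y) \<in> A)"

definition row_succ :: "(nat \<times> nat) set \<Rightarrow> nat \<Rightarrow> nat \<Rightarrow> bool" where
  "row_succ A x y \<longleftrightarrow> (\<exists>y'>y. (x, y') \<in> A)"

definition col_succ :: "(nat \<times> nat) set \<Rightarrow> nat \<Rightarrow> nat \<Rightarrow> bool" where
  "col_succ A x y \<longleftrightarrow> (\<exists>x'>x. (x', y) \<in> A)"

text \<open>Since a point has at most one child of each kind, having 0 or 2 children means that it has a
  successor in its row iff it has one in its column.\<close>

definition cnat_on :: "nat set \<Rightarrow> nat set \<Rightarrow> (nat \<times> nat) set \<Rightarrow> bool" where
  "cnat_on I J A \<longleftrightarrow>
     finite A \<and> fst ` A = I \<and> snd ` A = J \<and> (Min I, Min J) \<in> A \<and>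
     (\<forall>(x, y)\<in>A. (x, y) \<noteq> (Min I, Min J) \<longrightarrow> row_pred A x y \<noteq> col_pred A x y) \<and>
     (\<forall>(x, y)\<in>A. row_succ A x y \<longleftrightarrow> col_succ A x y)"

text \<open>Transposition exchanges rows with columns, so each statement about rows or left subtrees
  carries over to columns or right subtrees.\<close>

lemma
  shows row_pred_swap: "row_pred (prod.swap ` A) x y \<longleftrightarrow> col_pred A y x"
    and col_pred_swap: "col_pred (prod.swap ` A) x y \<longleftrightarrow> row_pred A y x"
    and row_succ_swap: "row_succ (prod.swap ` A) x y \<longleftrightarrow> col_succ A y x"
    and col_succ_swap: "col_succ (prod.swap ` A) x y \<longleftrightarrow> row_succ A y x"
  by (auto simp: row_pred_def col_pred_def row_succ_def col_succ_def)

lemma cnat_on_swap: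
  assumes "cnat_on I J A"
  shows "cnat_on J I (prod.swap ` A)"
  using assms unfolding cnat_on_def row_pred_swap col_pred_swap row_succ_swap col_succ_swap
  by (force simp: image_image)

lemma cnat_on_swap_iff: "cnat_on J I (prod.swap ` A) \<longleftrightarrow> cnat_on I J A"
  using cnat_on_swap[of I J A] cnat_on_swap[of J I "prod.swap ` A"] by (auto simp: image_image)

lemma cnat_onD:
  assumes "cnat_on I J A"
  shows "finite A" "finite I" "finite J" "fst ` A = I" "snd ` A = J" "(Min I, Min J) \<in> A"
    and "A \<subseteq> I \<times> J" "I \<noteq> {}" "J \<noteq> {}"
proof -
  show A: "finite A" "fst ` A = I" "snd ` A = J" "(Min I, Min J) \<in> A"
    using assms unfolding cnat_on_def by blast+
  then show "finite I" "finite J" by auto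
  show "A \<subseteq> I \<times> J" unfolding A(2,3)[symmetric] by (rule subset_fst_snd)
  show "I \<noteq> {}" "J \<noteq> {}" using A(2-4) by auto
qed

section \<open>Counting rows, columns, leaves and internal vertices\<close>

text \<open>Each row that meets \<open>A\<close> contains exactly one last point, so
  \<open>fst\<close> is a bijection from the last points to the rows.\<close>

lemma card_row_last:
  assumes "finite A"
  shows "card {p \<in> A. \<not> row_succ A (fst p) (snd p)} = card (fst ` A)"
proof -
  have "inj_on fst {p \<in> A. \<not> row_succ A (fst p) (snd p)}"
    by (auto simp: inj_on_def row_succ_def) (metis linorder_neqE_nat)
  moreover have "fst ` {p \<in> A. \<not> row_succ A (fst p) (snd p)} = fst ` A"
  proof (intro equalityI subsetI)
    fix x assume "x \<in> fst ` A"
    then have ne: "{y. (x, y) \<in> A} \<noteq> {}" by force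
    have "finite {y. (x, y) \<in> A}"
      using finite_imageI[OF assms, of snd] by (rule rev_finite_subset) force
    from Max_in[OF this ne] Max_ge[OF this]
    have "(x, Max {y. (x, y) \<in> A}) \<in> {p \<in> A. \<not> row_succ A (fst p) (snd p)}"
      by (auto simp: row_succ_def leD)
    then show "x \<in> fst ` {p \<in> A. \<not> row_succ A (fst p) (snd p)}" by force
  qed auto
  ultimately show ?thesis by (simp flip: card_image)
qed

lemma card_row_first:
  assumes "finite A"
  shows "card {p \<in> A. \<not> row_pred A (fst p) (snd p)} = card (fst ` A)"
proof -
  have "inj_on fst {p \<in> A. \<not> row_pred A (fst p) (snd p)}"
    by (auto simp: inj_on_def row_pred_def) (metis linorder_neqE_nat)
  moreover have "fst ` {p \<in> A. \<not> row_pred A (fst p) (snd p)} = fst ` A"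
  proof (intro equalityI subsetI)
    fix x assume "x \<in> fst ` A"
    then have ne: "\<exists>y. (x, y) \<in> A" by force
    then have "(x, LEAST y. (x, y) \<in> A) \<in> A" by (metis LeastI)
    then have "(x, LEAST y. (x, y) \<in> A) \<in> {p \<in> A. \<not> row_pred A (fst p) (snd p)}"
      by (auto simp: row_pred_def dest: not_less_Least)
    then show "x \<in> fst ` {p \<in> A. \<not> row_pred A (fst p) (snd p)}" by force
  qed auto
  ultimately show ?thesis by (simp flip: card_image)
qed

lemma card_col_last:
  assumes "finite A"
  shows "card {p \<in> A. \<not> col_succ A (fst p) (snd p)} = card (snd ` A)"
proof -
  have "{p \<in> prod.swap ` A. \<not> row_succ (prod.swap ` A) (fst p) (snd p)} =
        prod.swap ` {p \<in> A. \<not> col_succ A (fst p) (snd p)}"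
    by (auto simp: row_succ_swap)
  with card_row_last[of "prod.swap ` A"] assms show ?thesis
    by (simp add: card_image image_image)
qed

lemma card_col_first:
  assumes "finite A"
  shows "card {p \<in> A. \<not> col_pred A (fst p) (snd p)} = card (snd ` A)"
proof -
  have "{p \<in> prod.swap ` A. \<not> row_pred (prod.swap ` A) (fst p) (snd p)} =
        prod.swap ` {p \<in> A. \<not> col_pred A (fst p) (snd p)}"
    by (auto simp: row_pred_swap)
  with card_row_first[of "prod.swap ` A"] assms show ?thesis
    by (simp add: card_image image_image)
qed

text \<open>The leaves are the points that are last in their row, and equally the points that are
  last in their column. Counting them in both ways compares rows with columns.\<close>

lemma cnat_on_card_eq:
  assumes "cnat_on I J A"
  shows "card I = card J"
proof -
  have "{p \<in> A. \<not> row_succ A (fst p) (snd p)} = {p \<in> A. \<not> col_succ A (fst p) (snd p)}"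
    using assms unfolding cnat_on_def by auto
  then show ?thesis
    using cnat_onD[OF assms] card_row_last[of A] card_col_last[of A] by simp
qed

text \<open>Every point except the root is first in exactly one of its row and its column, and every row has
  exactly one leaf, its last point.\<close>

lemma cnat_on_card_internal:
  assumes "cnat_on I J A"
  shows "card {p \<in> A. row_succ A (fst p) (snd p)} + 1 = card I"
proof -
  note D = cnat_onD[OF assms]
  let ?R = "{p \<in> A. \<not> row_pred A (fst p) (snd p)}"
  let ?C = "{p \<in> A. \<not> col_pred A (fst p) (snd p)}"
  have xor: "\<And>x y. (x, y) \<in> A \<Longrightarrow> (x, y) \<noteq> (Min I, Min J) \<Longrightarrow> row_pred A x y \<noteq> col_pred A x y"
    using assms unfolding cnat_on_def by blast
  have root: "\<not> row_pred A (Min I) (Min J)" "\<not> col_pred A (Min I) (Min J)"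
    using D(2,3,7) unfolding row_pred_def col_pred_def by (force simp: leD)+
  have "?R \<inter> ?C = {(Min I, Min J)}"
    using xor root D(6) by force
  moreover have "?R \<union> ?C = A"
    using xor root by force
  ultimately have "card I + card J = card A + 1"
    using card_Un_Int[of ?R ?C] D card_row_first[of A] card_col_first[of A] by simp
  moreover have "card A = card {p \<in> A. row_succ A (fst p) (snd p)}
      + card {p \<in> A. \<not> row_succ A (fst p) (snd p)}"
    using D(1) by (subst card_Un_disjoint[symmetric]) (auto intro!: arg_cong[where f=card])
  ultimately show ?thesis
    using card_row_last[OF D(1)] D(4) cnat_on_card_eq[OF assms] by simp
qed

section \<open>Children as nearest successors, and the link to complete non-ambiguous trees\<close>

lemma is_least_iff:
  fixes P :: "nat \<Rightarrow> bool"
  shows "P v \<and> (\<forall>z. P z \<longrightarrow> v \<le> z) \<longleftrightarrow> (\<exists>z. P z) \<and> v = Least P"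
  by (auto intro: Least_equality[symmetric] Least_le LeastI)

text \<open>\<open>right_child\<close> makes the parent the nearest point before the child. As no
  point lies between the two, the child is the nearest point after the parent, hence unique.\<close>

lemma right_child_iff:
  assumes "(x, y) \<in> A"
  shows "right_child A (x, y) c \<longleftrightarrow> row_succ A x y \<and> c = (x, LEAST y'. y < y' \<and> (x, y') \<in> A)"
proof -
  obtain u v where c: "c = (u, v)" by fastforce
  let ?P = "\<lambda>y'. y < y' \<and> (x, y') \<in> A"
  have "right_child A (x, y) c \<longleftrightarrow> u = x \<and> (?P v \<and> (\<forall>z. ?P z \<longrightarrow> v \<le> z))"
    using assms unfolding right_child_def c by (auto simp: not_le[symmetric])
  then show ?thesis unfolding row_succ_def c is_least_iff[of ?P] by auto
qed

lemma left_child_iff: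
  assumes "(x, y) \<in> A"
  shows "left_child A (x, y) c \<longleftrightarrow> col_succ A x y \<and> c = (LEAST x'. x < x' \<and> (x', y) \<in> A, y)"
proof -
  have "left_child A (x, y) c \<longleftrightarrow> right_child (prod.swap ` A) (y, x) (prod.swap c)"
    unfolding left_child_def right_child_def by (cases c) auto
  also have "\<dots> \<longleftrightarrow> row_succ (prod.swap ` A) y x \<and>
      prod.swap c = (y, LEAST x'. x < x' \<and> (y, x') \<in> prod.swap ` A)"
    using assms by (intro right_child_iff) auto
  finally show ?thesis by (cases c) (auto simp: row_succ_swap)
qed

lemma card_children:
  assumes "(x, y) \<in> A"
  shows "card (children A (x, y)) =
    (if row_succ A x y then 1 else 0) + (if col_succ A x y then 1 else 0)"
proof -
  let ?l = "(LEAST x'. x < x' \<and> (x', y) \<in> A, y)" and ?r = "(x, LEAST y'. y < y' \<and> (x, y') \<in> A)"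
  \<comment> \<open>The left child lies in a strictly later row than \<open>x\<close>, the right
    child in row \<open>x\<close> itself, so the two never coincide.\<close>
  have "?l \<noteq> ?r" if "col_succ A x y"
    using LeastI_ex[of "\<lambda>x'. x < x' \<and> (x', y) \<in> A"] that unfolding col_succ_def by auto
  moreover have "children A (x, y) =
      (if row_succ A x y then {?r} else {}) \<union> (if col_succ A x y then {?l} else {})"
    unfolding children_def by (auto simp: right_child_iff[OF assms] left_child_iff[OF assms])
  ultimately show ?thesis by (auto simp: card_insert_if)
qed

lemma
  assumes "(x, y) \<in> A"
  shows card_children_eq_2: "card (children A (x, y)) = 2 \<longleftrightarrow> row_succ A x y \<and> col_succ A x y"
    and card_children_0_2: "card (children A (x, y)) \<in> {0, 2} \<longleftrightarrow> (row_succ A x y \<longleftrightarrow> col_succ A x y)"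
  by (simp_all add: card_children[OF assms])

lemma down_closed_eq_atMost:
  fixes I :: "nat set"
  assumes "finite I" "I \<noteq> {}" "\<And>x x'. x \<in> I \<Longrightarrow> x' < x \<Longrightarrow> x' \<in> I"
  shows "I = {..card I - 1}"
proof -
  have "x \<in> I \<longleftrightarrow> x \<le> Max I" for x
    using assms(1) Max_in[OF assms(1,2)] Max_ge[of I x] assms(3)[of "Max I" x]
    by (auto simp: le_less)
  then have "I = {..Max I}" by blast
  then show ?thesis by (metis card_atMost diff_Suc_1)
qed


lemma
  shows Bex_row_pred: "(\<exists>q\<in>A. fst q = x \<and> snd q < y) \<longleftrightarrow> row_pred A x y"
    and Bex_col_pred: "(\<exists>q\<in>A. snd q = y \<and> fst q < x) \<longleftrightarrow> col_pred A x y"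
  unfolding row_pred_def col_pred_def by force+

lemma non_ambiguous_tree_iff:
  "non_ambiguous_tree A \<longleftrightarrow> finite A \<and> (0, 0) \<in> A \<and>
     (\<forall>(x, y)\<in>A. (x, y) \<noteq> (0, 0) \<longrightarrow> row_pred A x y \<noteq> col_pred A x y) \<and>
     (\<forall>x\<in>fst ` A. {..<x} \<subseteq> fst ` A) \<and> (\<forall>y\<in>snd ` A. {..<y} \<subseteq> snd ` A)"
proof -
  have "(\<exists>q\<in>A. fst q = x) \<longleftrightarrow> x \<in> fst ` A" "(\<exists>q\<in>A. snd q = x) \<longleftrightarrow> x \<in> snd ` A" for x
    by auto
  then show ?thesis
    unfolding non_ambiguous_tree_def Bex_row_pred Bex_col_pred
    by (intro conj_cong refl; auto)
qed

text \<open>By condition (3) the occupied rows and columns form initial segments of the naturals. A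
  complete tree has one row and one column more than internal vertices, so fixing \<open>k\<close>
  fixes both segments as \<open>{..k}\<close>.\<close>

lemma cnat_on_complete_iff:
  "complete_non_ambiguous_tree A \<and> card (internal_vertices A) = k \<longleftrightarrow> cnat_on {..k} {..k} A"
proof
  assume A: "complete_non_ambiguous_tree A \<and> card (internal_vertices A) = k"
  then have nat: "non_ambiguous_tree A" and ch: "\<And>p. p \<in> A \<Longrightarrow> card (children A p) \<in> {0, 2}"
    unfolding complete_non_ambiguous_tree_def by auto
  have fin: "finite A" and root: "(0, 0) \<in> A" using nat unfolding non_ambiguous_tree_def by auto
  define I J where "I = fst ` A" and "J = snd ` A"
  have "\<And>x x'. x \<in> I \<Longrightarrow> x' < x \<Longrightarrow> x' \<in> I" "\<And>x x'. x \<in> J \<Longrightarrow> x' < x \<Longrightarrow> x' \<in> J"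
    using nat unfolding non_ambiguous_tree_iff I_def J_def by blast+
  then have IJ: "I = {..card I - 1}" "J = {..card J - 1}"
    using fin root down_closed_eq_atMost[of I] down_closed_eq_atMost[of J]
    unfolding I_def J_def by blast+
  then have "Min I = 0" "Min J = 0" by (metis Min_eqI atMost_iff finite_atMost le0)+
  then have "cnat_on I J A"
    unfolding cnat_on_def
  proof (intro conjI)
    show "\<forall>(x, y)\<in>A. row_succ A x y \<longleftrightarrow> col_succ A x y"
      using ch card_children_0_2[of _ _ A] by blast
    show "\<forall>(x, y)\<in>A. (x, y) \<noteq> (Min I, Min J) \<longrightarrow> row_pred A x y \<noteq> col_pred A x y"
      using nat \<open>Min I = 0\<close> \<open>Min J = 0\<close>
      unfolding non_ambiguous_tree_iff by simp
  qed (use fin root in \<open>simp_all add: I_def J_def\<close>)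
  moreover have "card (children A p) = 2 \<longleftrightarrow> row_succ A (fst p) (snd p)" if "p \<in> A" for p
    using that ch[of p] card_children_eq_2[of "fst p" "snd p" A] card_children_0_2[of "fst p" "snd p" A]
    by auto
  then have "internal_vertices A = {p \<in> A. row_succ A (fst p) (snd p)}"
    unfolding internal_vertices_def by auto
  ultimately have "card I = k + 1" "card J = k + 1"
    using cnat_on_card_internal[of I J A] cnat_on_card_eq[of I J A] A by auto
  with IJ \<open>cnat_on I J A\<close> show "cnat_on {..k} {..k} A" by simp
next
  assume A: "cnat_on {..k} {..k} A"
  note D = cnat_onD[OF A]
  have [simp]: "Min {..k} = 0" by (intro Min_eqI) auto
  have ch: "\<And>x y. (x, y) \<in> A \<Longrightarrow> row_succ A x y \<longleftrightarrow> col_succ A x y"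
    using A unfolding cnat_on_def by auto
  have "non_ambiguous_tree A"
    unfolding non_ambiguous_tree_iff D(4,5)
    using D(1,6) A unfolding cnat_on_def by auto
  moreover have "card (children A p) = 2 \<longleftrightarrow> row_succ A (fst p) (snd p)" if "p \<in> A" for p
    using that ch[of "fst p" "snd p"] card_children_eq_2[of "fst p" "snd p" A] card_children_0_2[of "fst p" "snd p" A]
    by auto
  then have "internal_vertices A = {p \<in> A. row_succ A (fst p) (snd p)}"
    unfolding internal_vertices_def by auto
  moreover have "card (children A p) \<in> {0, 2}" if "p \<in> A" for p
    using that ch[of "fst p" "snd p"] card_children_0_2[of "fst p" "snd p" A] by simp
  ultimately show "complete_non_ambiguous_tree A \<and> card (internal_vertices A) = k"
    using cnat_on_card_internal[OF A] unfolding complete_non_ambiguous_tree_def by auto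
qed

section \<open>Order-preserving relabelling of rows and columns\<close>

text \<open>All conditions in \<open>cnat_on\<close> compare coordinates only by their order, which
  strictly monotone maps preserve and reflect.\<close>

lemma cnat_on_image:
  assumes A: "cnat_on I J A" and f: "strict_mono_on I f" and g: "strict_mono_on J g"
  shows "cnat_on (f ` I) (g ` J) (map_prod f g ` A)"
proof -
  note D = cnat_onD[OF A]
  have sub: "x \<in> I" "y \<in> J" if "(x, y) \<in> A" for x y using D(7) that by auto
  have less: "f x < f x' \<longleftrightarrow> x < x'" "f x = f x' \<longleftrightarrow> x = x'" if "x \<in> I" "x' \<in> I" for x x'
    using strict_mono_on_less[OF f that] strict_mono_on_eq[OF f that] by auto
  have less': "g x < g x' \<longleftrightarrow> x < x'" "g x = g x' \<longleftrightarrow> x = x'" if "x \<in> J" "x' \<in> J" for x x'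
    using strict_mono_on_less[OF g that] strict_mono_on_eq[OF g that] by auto
  have mono: "mono_on I f" "mono_on J g"
    using f g by (auto intro: strict_mono_on_imp_mono_on)
  have "Min (h ` K) = h (Min K)" if "finite K" "K \<noteq> {}" "mono_on K h" for h :: "nat \<Rightarrow> nat" and K
  proof (rule Min_eqI)
    show "h (Min K) \<le> y" if "y \<in> h ` K" for y
      using that \<open>finite K\<close> mono_onD[OF \<open>mono_on K h\<close>] Min_in[OF \<open>finite K\<close> \<open>K \<noteq> {}\<close>] by auto
  qed (use that in auto)
  with mono D(2,3,8,9) have Min: "Min (f ` I) = f (Min I)" "Min (g ` J) = g (Min J)" by simp_all
  let ?B = "map_prod f g ` A"
  have pred: "row_pred ?B (f x) (g y) \<longleftrightarrow> row_pred A x y"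
             "col_pred ?B (f x) (g y) \<longleftrightarrow> col_pred A x y"
             "row_succ ?B (f x) (g y) \<longleftrightarrow> row_succ A x y"
             "col_succ ?B (f x) (g y) \<longleftrightarrow> col_succ A x y" if "(x, y) \<in> A" for x y
  proof -
    note xy = sub[OF that]
    \<comment> \<open>The condition \<open>Q\<close> on the free coordinate is arbitrary, so one
      equivalence serves both predecessors and successors.\<close>
    have row: "(\<exists>v. Q v \<and> (f x, v) \<in> ?B) \<longleftrightarrow> (\<exists>y'. Q (g y') \<and> (x, y') \<in> A)" for Q
      using less(2)[OF xy(1) sub(1)] by auto
    have col: "(\<exists>v. Q v \<and> (v, g y) \<in> ?B) \<longleftrightarrow> (\<exists>x'. Q (f x') \<and> (x', y) \<in> A)" for Q
      using less'(2)[OF xy(2) sub(2)] by auto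
    show "row_pred ?B (f x) (g y) \<longleftrightarrow> row_pred A x y" "row_succ ?B (f x) (g y) \<longleftrightarrow> row_succ A x y"
      unfolding row_pred_def row_succ_def row
      using less'(1)[OF xy(2) sub(2)] less'(1)[OF sub(2) xy(2)] by blast+
    show "col_pred ?B (f x) (g y) \<longleftrightarrow> col_pred A x y" "col_succ ?B (f x) (g y) \<longleftrightarrow> col_succ A x y"
      unfolding col_pred_def col_succ_def col
      using less(1)[OF xy(1) sub(1)] less(1)[OF sub(1) xy(1)] by blast+
  qed
  show ?thesis
    unfolding cnat_on_def Min
  proof (intro conjI)
    show "fst ` ?B = f ` I" "snd ` ?B = g ` J"
      unfolding D(4,5)[symmetric] by force+
    show "(f (Min I), g (Min J)) \<in> ?B" using D(6) by force
    have "row_pred ?B (f x) (g y) \<noteq> col_pred ?B (f x) (g y)"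
      if "(x, y) \<in> A" "(f x, g y) \<noteq> (f (Min I), g (Min J))" for x y
    proof -
      have "(x, y) \<noteq> (Min I, Min J)" using that(2) by auto
      then have "row_pred A x y \<noteq> col_pred A x y"
        using A that(1) unfolding cnat_on_def by blast
      then show ?thesis using pred(1,2)[OF that(1)] by simp
    qed
    then show "\<forall>(x, y)\<in>?B. (x, y) \<noteq> (f (Min I), g (Min J)) \<longrightarrow> row_pred ?B x y \<noteq> col_pred ?B x y"
      by auto
    have "row_succ A x y \<longleftrightarrow> col_succ A x y" if "(x, y) \<in> A" for x y
      using A that unfolding cnat_on_def by blast
    then show "\<forall>(x, y)\<in>?B. row_succ ?B x y \<longleftrightarrow> col_succ ?B x y"
      using pred by auto
  qed (use D(1) in simp)
qed

lemma finite_cnat_on: "finite I \<Longrightarrow> finite J \<Longrightarrow> finite {A. cnat_on I J A}"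
  by (rule finite_subset[of _ "Pow (I \<times> J)"]) (use cnat_onD(7) in auto)

text \<open>Compose the inverse of the increasing enumeration of \<open>I\<close> with the
  increasing enumeration of \<open>I'\<close>.\<close>

lemma ex_strict_mono_on_bij_betw:
  fixes I I' :: "nat set"
  assumes "finite I" "finite I'" "card I = card I'"
  shows "\<exists>f. bij_betw f I I' \<and> strict_mono_on I f"
proof -
  obtain h where h: "bij_betw h {..<card I} I" "strict_mono_on {..<card I} h"
    using ex_bij_betw_strict_mono_card[OF assms(1)] by blast
  obtain h' where h': "bij_betw h' {..<card I} I'" "strict_mono_on {..<card I} h'"
    using ex_bij_betw_strict_mono_card[OF assms(2)] assms(3) by metis
  let ?k = "inv_into {..<card I} h"
  have k: "bij_betw ?k I {..<card I}" using h(1) by (rule bij_betw_inv_into)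
  have "strict_mono_on I (h' \<circ> ?k)"
  proof (rule strict_mono_onI)
    fix x y assume xy: "x \<in> I" "y \<in> I" "x < y"
    then have "?k x \<in> {..<card I}" "?k y \<in> {..<card I}" "h (?k x) = x" "h (?k y) = y"
      using k bij_betw_apply[OF k] bij_betw_inv_into_right[OF h(1)] by blast+
    with xy(3) show "(h' \<circ> ?k) x < (h' \<circ> ?k) y"
      using strict_mono_on_less[OF h(2)] strict_mono_on_less[OF h'(2)] by fastforce
  qed
  with bij_betw_trans[OF k h'(1)] show ?thesis by blast
qed

text \<open>Relabelling sends trees injectively to trees. The hypotheses are symmetric, so
  \<open>card_cnat_on\<close> obtains equality from both directions.\<close>

lemma card_cnat_on_le:
  assumes "finite I" "finite J" "finite I'" "finite J'" "card I = card I'" "card J = card J'"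
  shows "card {A. cnat_on I J A} \<le> card {A. cnat_on I' J' A}"
proof -
  obtain f g where f: "bij_betw f I I'" "strict_mono_on I f"
    and g: "bij_betw g J J'" "strict_mono_on J g"
    using ex_strict_mono_on_bij_betw assms by meson
  have im: "f ` I = I'" "g ` J = J'" and inj: "inj_on f I" "inj_on g J"
    using f(1) g(1) by (auto simp: bij_betw_def)
  show ?thesis
  proof (rule card_inj_on_le)
    show "inj_on (image (map_prod f g)) {A. cnat_on I J A}"
    proof (rule inj_on_subset)
      show "inj_on (image (map_prod f g)) (Pow (I \<times> J))"
        using map_prod_inj_on[OF inj] by (simp add: inj_on_image_Pow)
    qed (use cnat_onD(7) in auto)
    show "image (map_prod f g) ` {A. cnat_on I J A} \<subseteq> {A. cnat_on I' J' A}"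
      using cnat_on_image[OF _ f(2) g(2)] im by auto
  qed (use finite_cnat_on assms in auto)
qed

text \<open>Relabelling reduces nonempty sets of equal size to \<open>{..k}\<close> with
  \<open>k = card I - 1\<close>, because \<open>k\<close> internal vertices occupy
  \<open>k + 1\<close> rows. In the other cases there is no tree, by \<open>cnat_on_card_eq\<close>
  and nonemptiness.\<close>

lemma card_cnat_on:
  assumes "finite I" "finite J"
  shows "card {A. cnat_on I J A} =
    (if card I = card J \<and> card I > 0 then num_complete_nat (card I - 1) else 0)"
proof (cases "card I = card J \<and> card I > 0")
  case True
  then have "card {A. cnat_on I J A} = card {A. cnat_on {..card I - 1} {..card I - 1} A}"
    using assms by (intro antisym card_cnat_on_le) auto
  then show ?thesis using True by (simp add: num_complete_nat_def cnat_on_complete_iff)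
next
  case False
  have "\<not> cnat_on I J A" for A
    using False cnat_on_card_eq[of I J A] cnat_onD(2,8)[of I J A] by (auto simp: card_gt_0_iff)
  then show ?thesis unfolding if_not_P[OF False] by simp
qed

section \<open>Decomposition at the root\<close>

text \<open>Without its root, a tree falls into two components that share no row and no column; \<open>S\<close>
  collects the rows of the left subtree and \<open>T\<close> the columns of the right subtree.\<close>

definition splits :: "nat \<times> nat \<Rightarrow> (nat \<times> nat) set \<Rightarrow> nat set \<Rightarrow> nat set \<Rightarrow> bool" where
  "splits r A S T \<longleftrightarrow> (\<forall>(x, y)\<in>A. (x, y) \<noteq> r \<longrightarrow> (x \<in> S \<longleftrightarrow> y \<notin> T))"

lemma splits_swap: "splits (b, a) (prod.swap ` A) T S \<longleftrightarrow> splits (a, b) A S T"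
  unfolding splits_def by auto

text \<open>Here \<open>B\<close> is a tree without its root \<open>(a, b)\<close>. Points are added
  by increasing coordinate sum; predecessors have a smaller sum, so a new point never changes the
  predecessor conditions of earlier ones. Completeness is not assumed, which keeps the hypotheses
  stable under removing the last point.\<close>

lemma ex_splits:
  assumes "finite B" "\<forall>(x, y)\<in>B. (x, y) \<noteq> (a, b) \<and> a \<le> x \<and> b \<le> y \<and>
    row_pred (insert (a, b) B) x y \<noteq> col_pred (insert (a, b) B) x y"
  shows "\<exists>S T. S \<subseteq> fst ` B - {a} \<and> T \<subseteq> snd ` B - {b} \<and> splits (a, b) B S T"
  using assms
proof (induction B rule: finite_ranking_induct[where f="\<lambda>p. fst p + snd p"])
  case empty
  then show ?case by (auto simp: splits_def)
next
  case (insert p B)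
  show ?case
  proof (cases "p \<in> B")
    case True
    then show ?thesis using insert by (simp add: insert_absorb)
  next
    case False
    obtain x y where p: "p = (x, y)" by fastforce
    let ?B = "insert (a, b) B" and ?B' = "insert (a, b) (insert p B)"
    have pB: "p \<noteq> (a, b)" "a \<le> x" "b \<le> y" "row_pred ?B' x y \<noteq> col_pred ?B' x y"
      using insert.prems unfolding p by auto
    have le: "u + v \<le> x + y" if "(u, v) \<in> B" for u v
      using insert.hyps(2)[OF that] p by simp
    have pred: "row_pred ?B' u v \<longleftrightarrow> row_pred ?B u v" "col_pred ?B' u v \<longleftrightarrow> col_pred ?B u v"
      if "u + v \<le> x + y" for u v
      using that unfolding row_pred_def col_pred_def p by auto
    have "\<forall>(x, y)\<in>B. (x, y) \<noteq> (a, b) \<and> a \<le> x \<and> b \<le> y \<and> row_pred ?B x y \<noteq> col_pred ?B x y"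
      using insert.prems pred le by fastforce
    from insert.IH[OF this] obtain S T where
      ST: "S \<subseteq> fst ` B - {a}" "T \<subseteq> snd ` B - {b}" "splits (a, b) B S T" by blast
    have "row_pred ?B x y \<noteq> col_pred ?B x y" using pB(4) pred[of x y] by simp
    then consider (row) "\<not> col_pred ?B x y" | (col) "\<not> row_pred ?B x y" by blast
    then show ?thesis
    proof cases
      case row
      then have "y \<noteq> b" using pB unfolding col_pred_def p by (auto simp: le_less)
      moreover have "(u, y) \<notin> B" for u
        using row le[of u y] False unfolding col_pred_def p by (auto simp: le_less)
      \<comment> \<open>Column \<open>y\<close> contains no earlier point and is not the column of
        the root, so membership of \<open>y\<close> in \<open>T\<close> can be chosen freely to suit
        the new point.\<close>
      ultimately have "splits (a, b) (insert p B) S (if x \<in> S then T - {y} else insert y T)"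
        using ST unfolding splits_def p by auto
      moreover have "S \<subseteq> fst ` insert p B - {a}" using ST by auto
      moreover have "(if x \<in> S then T - {y} else insert y T) \<subseteq> snd ` insert p B - {b}"
        using ST \<open>y \<noteq> b\<close> unfolding p by auto
      ultimately show ?thesis by blast
    next
      case col
      then have "x \<noteq> a" using pB unfolding row_pred_def p by (auto simp: le_less)
      moreover have "(x, v) \<notin> B" for v
        using col le[of x v] False unfolding row_pred_def p by (auto simp: le_less)
      ultimately have "splits (a, b) (insert p B) (if y \<in> T then S - {x} else insert x S) T"
        using ST unfolding splits_def p by auto
      moreover have "T \<subseteq> snd ` insert p B - {b}" using ST by auto
      moreover have "(if y \<in> T then S - {x} else insert x S) \<subseteq> fst ` insert p B - {a}"
        using ST \<open>x \<noteq> a\<close> unfolding p by auto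
      ultimately show ?thesis by blast
    qed
  qed
qed

lemma cnat_on_ex_splits:
  assumes "cnat_on I J A"
  shows "\<exists>S T. S \<subseteq> I - {Min I} \<and> T \<subseteq> J - {Min J} \<and> splits (Min I, Min J) A S T"
proof -
  note D = cnat_onD[OF assms]
  let ?r = "(Min I, Min J)"
  have ins: "insert ?r (A - {?r}) = A" using D(6) by auto
  have "Min I \<le> x \<and> Min J \<le> y" if "(x, y) \<in> A" for x y
    using D(2,3,7) that by auto
  then have "\<forall>(x, y)\<in>A - {?r}. (x, y) \<noteq> ?r \<and> Min I \<le> x \<and> Min J \<le> y \<and>
      row_pred (insert ?r (A - {?r})) x y \<noteq> col_pred (insert ?r (A - {?r})) x y"
    using assms unfolding cnat_on_def ins by blast
  then have "\<exists>S T. S \<subseteq> fst ` (A - {?r}) - {Min I} \<and> T \<subseteq> snd ` (A - {?r}) - {Min J} \<and>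
      splits ?r (A - {?r}) S T"
    using D(1) by (intro ex_splits) auto
  moreover have "splits ?r (A - {?r}) S T \<longleftrightarrow> splits ?r A S T" for S T
    unfolding splits_def by auto
  moreover have "fst ` (A - {?r}) \<subseteq> I" "snd ` (A - {?r}) \<subseteq> J" using D(4,5) by auto
  ultimately show ?thesis by (meson Diff_mono order_refl order_trans)
qed

text \<open>The row of the root lies outside \<open>S\<close> and its column outside
  \<open>T\<close>. Every other point shares a row or column with a predecessor, and the splitting
  condition then decides its other line. The induction is on the coordinate sum.\<close>

lemma splits_unique:
  assumes A: "cnat_on I J A"
    and ST: "S \<subseteq> I - {Min I}" "T \<subseteq> J - {Min J}" "splits (Min I, Min J) A S T"
    and ST': "S' \<subseteq> I - {Min I}" "T' \<subseteq> J - {Min J}" "splits (Min I, Min J) A S' T'"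
  shows "S = S' \<and> T = T'"
proof -
  note D = cnat_onD[OF A]
  let ?r = "(Min I, Min J)"
  have coh: "x \<in> S \<longleftrightarrow> y \<notin> T" "x \<in> S' \<longleftrightarrow> y \<notin> T'" if "(x, y) \<in> A" "(x, y) \<noteq> ?r" for x y
    using ST(3) ST'(3) that unfolding splits_def by auto
  have "(x \<in> S \<longleftrightarrow> x \<in> S') \<and> (y \<in> T \<longleftrightarrow> y \<in> T')" if "(x, y) \<in> A" for x y
    using that
  proof (induction "x + y" arbitrary: x y rule: less_induct)
    case less
    show ?case
    proof (cases "(x, y) = ?r")
      case True
      then show ?thesis using ST ST' by auto
    next
      case False
      then have "row_pred A x y \<or> col_pred A x y"
        using A less.prems unfolding cnat_on_def by blast
      then show ?thesis
      proof
        assume "row_pred A x y"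
        then obtain y' where "y' < y" "(x, y') \<in> A" unfolding row_pred_def by blast
        with less.hyps[of x y'] coh[OF less.prems False] show ?thesis by auto
      next
        assume "col_pred A x y"
        then obtain x' where "x' < x" "(x', y) \<in> A" unfolding col_pred_def by blast
        with less.hyps[of x' y] coh[OF less.prems False] show ?thesis by auto
      qed
    qed
  qed
  then have "\<forall>x\<in>fst ` A. x \<in> S \<longleftrightarrow> x \<in> S'" "\<forall>y\<in>snd ` A. y \<in> T \<longleftrightarrow> y \<in> T'" by auto
  with ST ST' show ?thesis unfolding D(4,5) by blast
qed

text \<open>The left subtree starts in the column of the root of \<open>A\<close>, so its columns
  are \<open>J - T\<close>, including \<open>Min J\<close>, and its own root is
  \<open>(Min S, Min J)\<close>. The assumption \<open>card I > 1\<close> ensures that the root of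
  \<open>A\<close> has children.\<close>

lemma cnat_on_left_subtree:
  assumes A: "cnat_on I J A" "card I > 1"
    and S: "S \<subseteq> I - {Min I}" and T: "T \<subseteq> J - {Min J}" and spl: "splits (Min I, Min J) A S T"
  shows "cnat_on S (J - T) (A \<inter> S \<times> (J - T))"
proof -
  note D = cnat_onD[OF A(1)]
  define r L where "r = (Min I, Min J)" and "L = A \<inter> S \<times> (J - T)"
  have coh: "x \<in> S \<longleftrightarrow> y \<notin> T" if "(x, y) \<in> A" "(x, y) \<noteq> r" for x y
    using spl that unfolding splits_def r_def by auto
  have xor: "row_pred A x y \<noteq> col_pred A x y" if "(x, y) \<in> A" "(x, y) \<noteq> r" for x y
    using A(1) that unfolding cnat_on_def r_def by blast
  have compl: "row_succ A x y \<longleftrightarrow> col_succ A x y" if "(x, y) \<in> A" for x y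
    using A(1) that unfolding cnat_on_def by blast
  have IJ: "x \<in> I" "y \<in> J" "Min I \<le> x" "Min J \<le> y" if "(x, y) \<in> A" for x y
    using that D(2,3,7) by auto
  \<comment> \<open>Away from \<open>r\<close>, membership in \<open>L\<close> can be read off from
    the row alone or from the column alone. This transfers row and column conditions between
    \<open>L\<close> and \<open>A\<close>.\<close>
  have LA: "(x, y) \<in> L \<longleftrightarrow> (x, y) \<in> A \<and> x \<in> S" for x y
    using coh[of x y] S IJ unfolding L_def r_def by auto
  have LA': "(x, y) \<in> L \<longleftrightarrow> (x, y) \<in> A \<and> y \<notin> T \<and> (x, y) \<noteq> r" for x y
    using coh[of x y] S T IJ unfolding L_def r_def by auto
  have "A \<noteq> {r}" using A(2) D(4) by auto
  then obtain u v where uv: "(u, v) \<in> A" "(u, v) \<noteq> r" using D(6) unfolding r_def by auto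
  \<comment> \<open>A point other than the root with least coordinate sum has a predecessor, which
    can only be the root.\<close>
  have "row_succ A (Min I) (Min J) \<or> col_succ A (Min I) (Min J)"
  proof -
    let ?P = "\<lambda>n. \<exists>u v. (u, v) \<in> A \<and> (u, v) \<noteq> r \<and> n = u + v"
    have ex: "\<exists>n. ?P n" using uv by blast
    obtain u v where m: "(u, v) \<in> A" "(u, v) \<noteq> r" "(LEAST n. ?P n) = u + v"
      using LeastI_ex[OF ex] by blast
    have "(u', v') = r" if "(u', v') \<in> A" "u' + v' < u + v" for u' v'
      using that not_less_Least[of "u' + v'" ?P] m(3) by auto
    moreover have "row_pred A u v \<or> col_pred A u v" using xor[OF m(1,2)] by blast
    ultimately show ?thesis
      using m(1) unfolding row_pred_def col_pred_def row_succ_def col_succ_def r_def by fastforce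
  qed
  then have "col_succ A (Min I) (Min J)" using compl D(6) by blast
  then obtain x1 where x1: "x1 > Min I" "(x1, Min J) \<in> A" unfolding col_succ_def by blast
  then have x1L: "(x1, Min J) \<in> L" using T unfolding LA' r_def by auto
  have fstL: "fst ` L = S"
  proof (intro equalityI subsetI)
    fix x assume "x \<in> S"
    then have "x \<in> fst ` A" using S D(4) by auto
    then show "x \<in> fst ` L" using \<open>x \<in> S\<close> LA by force
  qed (auto simp: L_def)
  have sndL: "snd ` L = J - T"
  proof (intro equalityI subsetI)
    fix y assume y: "y \<in> J - T"
    then obtain x where x: "(x, y) \<in> A" using D(5) by force
    show "y \<in> snd ` L"
    proof (cases "(x, y) = r")
      case True
      then show ?thesis using x1L unfolding r_def by force
    next
      case False
      then have "(x, y) \<in> L" using LA' x y by blast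
      then show ?thesis by force
    qed
  qed (auto simp: L_def)
  have finS: "finite S" "S \<noteq> {}" using D(2) S x1L LA by (auto intro: rev_finite_subset)
  have MinJ: "Min (J - T) = Min J"
    using T D(3,9) by (intro Min_eqI) auto
  \<comment> \<open>The first point of row \<open>Min S\<close> has no row predecessor, hence a
    column predecessor. That one lies above row \<open>Min S\<close>, so outside \<open>L\<close>;
    only \<open>r\<close> qualifies, which puts the point in column \<open>Min J\<close>.\<close>
  have root: "(Min S, Min J) \<in> L"
  proof -
    let ?x = "Min S"
    have "\<exists>y. (?x, y) \<in> L" using Min_in[OF finS] fstL by force
    then have y: "(?x, LEAST y. (?x, y) \<in> L) \<in> L" by (rule LeastI_ex)
    let ?y = "LEAST y. (?x, y) \<in> L"
    have "\<not> row_pred A ?x ?y"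
    proof
      assume "row_pred A ?x ?y"
      then obtain y' where "y' < ?y" "(?x, y') \<in> A" unfolding row_pred_def by blast
      then show False using y LA not_less_Least[of y' "\<lambda>y. (?x, y) \<in> L"] by blast
    qed
    with xor[of ?x ?y] y obtain x' where x': "x' < ?x" "(x', ?y) \<in> A"
      unfolding LA' col_pred_def by blast
    have "x' \<notin> S" using x'(1) finS by (meson Min_le leD)
    then have "(x', ?y) = r" using LA LA' x' y by blast
    then show ?thesis using y unfolding r_def by simp
  qed
  have pred: "row_pred L x y \<longleftrightarrow> row_pred A x y" "row_succ L x y \<longleftrightarrow> row_succ A x y"
    if "(x, y) \<in> L" for x y
    using that unfolding row_pred_def row_succ_def LA by auto
  have succ: "col_succ L x y \<longleftrightarrow> col_succ A x y" if xy: "(x, y) \<in> L" for x y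
  proof -
    have "(x', y) \<noteq> r" if "x' > x" for x'
      using IJ(3)[of x y] that xy LA unfolding r_def by auto
    then show ?thesis using xy unfolding col_succ_def LA' by auto
  qed
  \<comment> \<open>The only predecessor lost in a column is \<open>r\<close>. For the other points
    of column \<open>Min J\<close>, the new root \<open>(Min S, Min J)\<close> replaces it.\<close>
  have cpred: "col_pred L x y \<longleftrightarrow> col_pred A x y" if xy: "(x, y) \<in> L" "(x, y) \<noteq> (Min S, Min J)" for x y
  proof
    assume "col_pred A x y"
    then obtain x' where x': "x' < x" "(x', y) \<in> A" unfolding col_pred_def by blast
    show "col_pred L x y"
    proof (cases "(x', y) = r")
      case True
      then have "y = Min J" "Min S < x"
        using xy LA[of x y] Min_le[OF finS(1), of x] unfolding r_def by (auto simp: le_less)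
      then show ?thesis using root unfolding col_pred_def by blast
    next
      case False
      then have "(x', y) \<in> L" using x' xy LA' by blast
      then show ?thesis using x' unfolding col_pred_def by blast
    qed
  qed (auto simp: col_pred_def LA)
  have "cnat_on S (J - T) L"
    unfolding cnat_on_def MinJ
  proof (intro conjI)
    show "\<forall>(x, y)\<in>L. (x, y) \<noteq> (Min S, Min J) \<longrightarrow> row_pred L x y \<noteq> col_pred L x y"
      using xor pred cpred LA' by blast
    show "\<forall>(x, y)\<in>L. row_succ L x y \<longleftrightarrow> col_succ L x y"
      using compl pred succ LA' by blast
  qed (use fstL sndL root D(1) in \<open>auto simp: L_def\<close>)
  then show ?thesis unfolding L_def .
qed

text \<open>Transposition turns this into the statement on left subtrees, with \<open>S\<close> and
  \<open>T\<close> exchanged.\<close>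

lemma cnat_on_right_subtree:
  assumes A: "cnat_on I J A" "card I > 1"
    and S: "S \<subseteq> I - {Min I}" and T: "T \<subseteq> J - {Min J}" and spl: "splits (Min I, Min J) A S T"
  shows "cnat_on (I - S) T (A \<inter> (I - S) \<times> T)"
proof -
  have "cnat_on T (I - S) (prod.swap ` A \<inter> T \<times> (I - S))"
    using A S T spl cnat_on_card_eq[OF A(1)]
    by (intro cnat_on_left_subtree[of J I]) (auto simp: cnat_on_swap_iff splits_swap)
  moreover have "prod.swap ` A \<inter> T \<times> (I - S) = prod.swap ` (A \<inter> (I - S) \<times> T)" by auto
  ultimately show ?thesis by (simp add: cnat_on_swap_iff)
qed

text \<open>The new root meets \<open>L\<close> only in column \<open>Min J\<close> and
  \<open>R\<close> only in row \<open>Min I\<close>, where it precedes every point. The only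
  predecessor conditions affected are those at the two old roots, each of which gains exactly one
  predecessor.\<close>

lemma cnat_on_join:
  assumes fin: "finite I" "finite J" and ne: "I \<noteq> {}" "J \<noteq> {}"
    and S: "S \<subseteq> I - {Min I}" and T: "T \<subseteq> J - {Min J}"
    and L: "cnat_on S (J - T) L" and R: "cnat_on (I - S) T R"
  shows "cnat_on I J (insert (Min I, Min J) (L \<union> R))"
    and "splits (Min I, Min J) (insert (Min I, Min J) (L \<union> R)) S T"
proof -
  note DL = cnat_onD[OF L] and DR = cnat_onD[OF R]
  define r A where "r = (Min I, Min J)" and "A = insert r (L \<union> R)"
  have mins: "Min (J - T) = Min J" "Min (I - S) = Min I"
    using S T fin Min_in[OF fin(1) ne(1)] Min_in[OF fin(2) ne(2)] by (auto intro!: Min_eqI)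
  have Lsub: "x \<in> S" "y \<in> J" "y \<notin> T" if "(x, y) \<in> L" for x y using DL(7) that by auto
  have Rsub: "x \<in> I" "x \<notin> S" "y \<in> T" if "(x, y) \<in> R" for x y using DR(7) that by auto
  have lo: "Min I < x" if "x \<in> S" for x
    using S that Min_le[OF fin(1), of x] by (auto simp: order.order_iff_strict)
  have lo': "Min J < y" if "y \<in> T" for y
    using T that Min_le[OF fin(2), of y] by (auto simp: order.order_iff_strict)
  have Lx: "row_pred L x y \<noteq> col_pred L x y" if "(x, y) \<in> L" "(x, y) \<noteq> (Min S, Min J)" for x y
    using L that unfolding cnat_on_def mins by blast
  have Rx: "row_pred R x y \<noteq> col_pred R x y" if "(x, y) \<in> R" "(x, y) \<noteq> (Min I, Min T)" for x y
    using R that unfolding cnat_on_def mins by blast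
  have Lc: "row_succ L x y \<longleftrightarrow> col_succ L x y" if "(x, y) \<in> L" for x y
    using L that unfolding cnat_on_def by blast
  have Rc: "row_succ R x y \<longleftrightarrow> col_succ R x y" if "(x, y) \<in> R" for x y
    using R that unfolding cnat_on_def by blast
  have rowL: "(x, v) \<in> A \<longleftrightarrow> (x, v) \<in> L" if "x \<in> S" for x v
    using that S Rsub unfolding A_def r_def by auto
  have colL: "(u, y) \<in> A \<longleftrightarrow> (u, y) \<in> L \<or> (u, y) = r" if "y \<notin> T" for u y
    using that Rsub unfolding A_def by auto
  have colR: "(u, y) \<in> A \<longleftrightarrow> (u, y) \<in> R" if "y \<in> T" for u y
    using that T Lsub unfolding A_def r_def by auto
  have rowR: "(x, v) \<in> A \<longleftrightarrow> (x, v) \<in> R \<or> (x, v) = r" if "x \<notin> S" for x v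
    using that Lsub unfolding A_def by auto
  have rootL: "(Min S, Min J) \<in> L" and rootR: "(Min I, Min T) \<in> R"
    using DL(6) DR(6) mins by simp_all
  have xorL: "row_pred A x y \<noteq> col_pred A x y" if xy: "(x, y) \<in> L" for x y
  proof -
    have row: "row_pred A x y \<longleftrightarrow> row_pred L x y"
      unfolding row_pred_def using rowL Lsub[OF xy] by auto
    have col: "col_pred A x y \<longleftrightarrow> col_pred L x y \<or> y = Min J"
      unfolding col_pred_def using colL[OF Lsub(3)[OF xy]] lo[OF Lsub(1)[OF xy]]
      unfolding r_def by auto
    show ?thesis
    proof (cases "(x, y) = (Min S, Min J)")
      case True
      have "\<not> row_pred L x y"
        using True Lsub fin unfolding row_pred_def by (auto simp: leD)
      then show ?thesis using True row col by auto
    next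
      case False
      \<comment> \<open>In column \<open>Min J\<close> every point of \<open>L\<close> but the old
        root already had that root as a predecessor, so the new one changes nothing.\<close>
      have "col_pred L x y" if "y = Min J"
      proof -
        have "Min S < x" using False that Min_le[OF DL(2) Lsub(1)[OF xy]]
          by (auto simp: order.order_iff_strict)
        then show ?thesis using rootL that unfolding col_pred_def by blast
      qed
      then show ?thesis using Lx[OF xy False] row col by blast
    qed
  qed
  have xorR: "row_pred A x y \<noteq> col_pred A x y" if xy: "(x, y) \<in> R" for x y
  proof -
    have col: "col_pred A x y \<longleftrightarrow> col_pred R x y"
      unfolding col_pred_def using colR Rsub[OF xy] by auto
    have row: "row_pred A x y \<longleftrightarrow> row_pred R x y \<or> x = Min I"
      unfolding row_pred_def using rowR[OF Rsub(2)[OF xy]] lo'[OF Rsub(3)[OF xy]]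
      unfolding r_def by auto
    show ?thesis
    proof (cases "(x, y) = (Min I, Min T)")
      case True
      have "\<not> col_pred R x y"
        using True Rsub fin unfolding col_pred_def by (auto simp: leD)
      then show ?thesis using True row col by auto
    next
      case False
      have "row_pred R x y" if "x = Min I"
      proof -
        have "Min T < y" using False that Min_le[OF DR(3) Rsub(3)[OF xy]]
          by (auto simp: order.order_iff_strict)
        then show ?thesis using rootR that unfolding row_pred_def by blast
      qed
      then show ?thesis using Rx[OF xy False] row col by blast
    qed
  qed
  have succL: "row_succ A x y \<longleftrightarrow> col_succ A x y" if xy: "(x, y) \<in> L" for x y
  proof -
    have "row_succ A x y \<longleftrightarrow> row_succ L x y"
      unfolding row_succ_def using rowL Lsub[OF xy] by auto
    moreover have "col_succ A x y \<longleftrightarrow> col_succ L x y"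
      unfolding col_succ_def using colL[OF Lsub(3)[OF xy]] lo[OF Lsub(1)[OF xy]]
      unfolding r_def by auto
    ultimately show ?thesis using Lc[OF xy] by simp
  qed
  have succR: "row_succ A x y \<longleftrightarrow> col_succ A x y" if xy: "(x, y) \<in> R" for x y
  proof -
    have "col_succ A x y \<longleftrightarrow> col_succ R x y"
      unfolding col_succ_def using colR Rsub[OF xy] by auto
    moreover have "row_succ A x y \<longleftrightarrow> row_succ R x y"
      unfolding row_succ_def using rowR[OF Rsub(2)[OF xy]] lo'[OF Rsub(3)[OF xy]]
      unfolding r_def by auto
    ultimately show ?thesis using Rc[OF xy] by simp
  qed
  \<comment> \<open>The old roots supply one child of each kind, so the new root is an internal
    vertex.\<close>
  have "row_succ A (Min I) (Min J)" "col_succ A (Min I) (Min J)"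
    using rootL rootR lo[OF Lsub(1)[OF rootL]] lo'[OF Rsub(3)[OF rootR]]
    unfolding row_succ_def col_succ_def A_def by blast+
  then have succ: "row_succ A x y \<longleftrightarrow> col_succ A x y" if "(x, y) \<in> A" for x y
    using that succL succR unfolding A_def r_def by blast
  have xor: "row_pred A x y \<noteq> col_pred A x y" if "(x, y) \<in> A" "(x, y) \<noteq> r" for x y
    using that xorL xorR unfolding A_def r_def by blast
  have "fst ` A = insert (Min I) (S \<union> (I - S))" "snd ` A = insert (Min J) ((J - T) \<union> T)"
    unfolding A_def r_def image_insert image_Un DL(4,5) DR(4,5) by simp_all
  then have "fst ` A = I" "snd ` A = J" using S T Min_in[OF fin(1) ne(1)] Min_in[OF fin(2) ne(2)] by auto
  then have "cnat_on I J A"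
    unfolding cnat_on_def using succ xor DL(1) DR(1) by (auto simp: A_def r_def)
  then show "cnat_on I J (insert (Min I, Min J) (L \<union> R))" unfolding A_def r_def .
  show "splits (Min I, Min J) (insert (Min I, Min J) (L \<union> R)) S T"
    unfolding splits_def using Lsub Rsub by auto
qed

text \<open>Cutting a tree at its root and joining two subtrees are mutually inverse.\<close>

lemma card_cnat_on_splits:
  assumes fin: "finite I" "finite J" and I: "card I > 1"
    and S: "S \<subseteq> I - {Min I}" and T: "T \<subseteq> J - {Min J}" and J: "J \<noteq> {}"
  shows "card {A. cnat_on I J A \<and> splits (Min I, Min J) A S T} =
    card {L. cnat_on S (J - T) L} * card {R. cnat_on (I - S) T R}"
proof -
  have I': "I \<noteq> {}" using I by auto
  let ?r = "(Min I, Min J)"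
  let ?f = "\<lambda>A. (A \<inter> S \<times> (J - T), A \<inter> (I - S) \<times> T)" and ?g = "\<lambda>(L, R). insert ?r (L \<union> R)"
  have "bij_betw ?f {A. cnat_on I J A \<and> splits ?r A S T}
      ({L. cnat_on S (J - T) L} \<times> {R. cnat_on (I - S) T R})"
  proof (rule bij_betw_byWitness[where f'="?g"])
    have "?g (?f A) = A" if A: "cnat_on I J A" "splits ?r A S T" for A
    proof -
      have "p \<in> ?g (?f A) \<longleftrightarrow> p \<in> A" for p
        using cnat_onD(6,7)[OF A(1)] A(2) unfolding splits_def by (cases p) auto
      then show ?thesis by blast
    qed
    then show "\<forall>A\<in>{A. cnat_on I J A \<and> splits ?r A S T}. ?g (?f A) = A"
      by blast
    have "?f (?g (L, R)) = (L, R)" if "cnat_on S (J - T) L" "cnat_on (I - S) T R" for L R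
      using S T cnat_onD(7)[OF that(1)] cnat_onD(7)[OF that(2)] by auto
    then show "\<forall>p\<in>{L. cnat_on S (J - T) L} \<times> {R. cnat_on (I - S) T R}. ?f (?g p) = p"
      by blast
    show "?f ` {A. cnat_on I J A \<and> splits ?r A S T} \<subseteq>
        {L. cnat_on S (J - T) L} \<times> {R. cnat_on (I - S) T R}"
      using cnat_on_left_subtree[OF _ I S T] cnat_on_right_subtree[OF _ I S T] by blast
    show "?g ` ({L. cnat_on S (J - T) L} \<times> {R. cnat_on (I - S) T R}) \<subseteq>
        {A. cnat_on I J A \<and> splits ?r A S T}"
      using cnat_on_join[OF fin I' J S T] by auto
  qed
  then show ?thesis by (simp add: bij_betw_same_card card_cartesian_product)
qed

text \<open>Each tree splits along exactly one pair \<open>(S, T)\<close>, so the pairs partition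
  the trees.\<close>

lemma card_cnat_on_eq_sum_splits:
  assumes fin: "finite I" "finite J" and I: "card I > 1" and J: "J \<noteq> {}"
  shows "card {A. cnat_on I J A} =
    (\<Sum>S\<in>Pow (I - {Min I}). \<Sum>T\<in>Pow (J - {Min J}).
      card {L. cnat_on S (J - T) L} * card {R. cnat_on (I - S) T R})"
proof -
  let ?X = "\<lambda>S T. {A. cnat_on I J A \<and> splits (Min I, Min J) A S T}"
  let ?P = "Pow (I - {Min I}) \<times> Pow (J - {Min J})"
  have "{A. cnat_on I J A} = (\<Union>(S, T)\<in>?P. ?X S T)"
    using cnat_on_ex_splits by fastforce
  also have "card \<dots> = (\<Sum>(S, T)\<in>?P. card (?X S T))"
    unfolding case_prod_beta'
  proof (rule card_UN_disjoint)
    show "\<forall>p\<in>?P. finite (?X (fst p) (snd p))"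
      using finite_cnat_on[OF fin] by (auto intro: rev_finite_subset)
    show "\<forall>p\<in>?P. \<forall>q\<in>?P. p \<noteq> q \<longrightarrow> ?X (fst p) (snd p) \<inter> ?X (fst q) (snd q) = {}"
      using splits_unique by (clarsimp simp: set_eq_iff) blast
  qed (use fin in auto)
  also have "\<dots> = (\<Sum>S\<in>Pow (I - {Min I}). \<Sum>T\<in>Pow (J - {Min J}). card (?X S T))"
    by (simp add: sum.cartesian_product)
  also have "\<dots> = (\<Sum>S\<in>Pow (I - {Min I}). \<Sum>T\<in>Pow (J - {Min J}).
      card {L. cnat_on S (J - T) L} * card {R. cnat_on (I - S) T R})"
    using card_cnat_on_splits[OF fin I _ _ J] by (intro sum.cong refl) auto
  finally show ?thesis .
qed

section \<open>The recurrence for the numbers of complete trees\<close>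

lemma sum_Pow_card:
  fixes h :: "nat \<Rightarrow> nat"
  assumes "finite K"
  shows "(\<Sum>S\<in>Pow K. h (card S)) = (\<Sum>s\<le>card K. (card K choose s) * h s)"
proof -
  have "(\<Sum>S\<in>Pow K. h (card S)) = (\<Sum>s\<le>card K. \<Sum>S | S \<in> Pow K \<and> card S = s. h (card S))"
    using assms by (intro sum.group[symmetric]) (auto intro: card_mono)
  also have "\<dots> = (\<Sum>s\<le>card K. (card K choose s) * h s)"
    using n_subsets[OF assms] by (intro sum.cong refl) simp
  finally show ?thesis .
qed

lemma num_complete_nat_0: "num_complete_nat 0 = 1"
proof -
  have "cnat_on {0} {0} A \<longleftrightarrow> A = {(0, 0)}" for A
    using cnat_onD(6,7)[of "{0}" "{0}" A]
    by (auto simp: cnat_on_def row_succ_def col_succ_def)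
  then have "{A. cnat_on {..0} {..0} A} = {{(0, 0)}}" by auto
  then show ?thesis unfolding num_complete_nat_def cnat_on_complete_iff by simp
qed

lemma num_complete_nat_Suc:
  "num_complete_nat (Suc n) = (\<Sum>u\<le>n. (Suc n choose Suc u) * (Suc n choose u) *
      (num_complete_nat u * num_complete_nat (n - u)))"
proof -
  let ?b = num_complete_nat
  define N where "N = Suc n"
  define I where "I = {..N}"
  define K where "K = I - {0}"
  have fin: "finite I" "finite K" and cI: "card I = Suc N" and cK: "card K = N"
    unfolding I_def K_def by auto
  have Min: "Min I = 0" unfolding I_def by (intro Min_eqI) auto
  \<comment> \<open>With \<open>s = card S\<close> and \<open>t = card T\<close>, the left subtree
    has \<open>s\<close> rows and \<open>Suc N - t\<close> columns, which must agree. The subtrees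
    then have \<open>s - 1\<close> and \<open>t - 1\<close> internal vertices.\<close>
  define h where "h = (\<lambda>s t. if s + t = Suc N \<and> s > 0 \<and> t > 0 then ?b (s - 1) * ?b (t - 1) else 0)"
  have "?b N = card {A. cnat_on I I A}"
    unfolding num_complete_nat_def cnat_on_complete_iff I_def ..
  also have "\<dots> = (\<Sum>S\<in>Pow K. \<Sum>T\<in>Pow K.
      card {L. cnat_on S (I - T) L} * card {R. cnat_on (I - S) T R})"
    using card_cnat_on_eq_sum_splits[of I I] fin cI unfolding Min K_def N_def by fastforce
  also have "\<dots> = (\<Sum>S\<in>Pow K. \<Sum>T\<in>Pow K. h (card S) (card T))"
  proof (intro sum.cong refl)
    fix S T assume ST: "S \<in> Pow K" "T \<in> Pow K"
    then have sub: "S \<subseteq> I" "T \<subseteq> I" "finite S" "finite T"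
      using fin rev_finite_subset unfolding K_def by blast+
    have "card S \<le> N" "card T \<le> N" using ST card_mono[OF fin(2)] cK by auto
    moreover have "card (I - S) = Suc N - card S" "card (I - T) = Suc N - card T"
      using sub by (simp_all add: card_Diff_subset cI)
    ultimately show "card {L. cnat_on S (I - T) L} * card {R. cnat_on (I - S) T R} = h (card S) (card T)"
      using fin sub by (auto simp: card_cnat_on h_def)
  qed
  also have "\<dots> = (\<Sum>s\<le>N. (N choose s) * (\<Sum>t\<le>N. (N choose t) * h s t))"
    using sum_Pow_card[OF fin(2)] unfolding cK by simp
  \<comment> \<open>For each \<open>s\<close> only \<open>t = Suc N - s\<close> contributes, and
    \<open>s = 0\<close> contributes nothing.\<close>
  also have "\<dots> = (\<Sum>s\<in>{1..N}. (N choose s) * ((N choose (Suc N - s)) * (?b (s - 1) * ?b (N - s))))"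
  proof (rule sum.mono_neutral_cong_right)
    show "(N choose s) * (\<Sum>t\<le>N. (N choose t) * h s t) =
        (N choose s) * ((N choose (Suc N - s)) * (?b (s - 1) * ?b (N - s)))" if "s \<in> {1..N}" for s
    proof -
      have "(\<Sum>t\<le>N. (N choose t) * h s t) = (\<Sum>t\<in>{Suc N - s}. (N choose t) * h s t)"
        using that by (intro sum.mono_neutral_right) (auto simp: h_def)
      also have "\<dots> = (N choose (Suc N - s)) * (?b (s - 1) * ?b (N - s))"
        using that by (auto simp: h_def)
      finally show ?thesis by simp
    qed
  qed (auto simp: h_def)
  \<comment> \<open>The new index \<open>u = s - 1\<close> is the number of internal vertices of the
    left subtree.\<close>
  also have "\<dots> = (\<Sum>u\<le>n. (Suc n choose Suc u) * ((Suc n choose (Suc n - u)) * (?b u * ?b (n - u))))"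
    by (rule sum.reindex_bij_witness[of _ Suc "\<lambda>s. s - 1"]) (auto simp: N_def)
  also have "\<dots> = (\<Sum>u\<le>n. (Suc n choose Suc u) * (Suc n choose u) * (?b u * ?b (n - u)))"
  proof (intro sum.cong refl)
    fix u assume "u \<in> {..n}"
    then have "Suc n choose (Suc n - u) = Suc n choose u"
      by (metis atMost_iff binomial_symmetric le_SucI)
    then show "(Suc n choose Suc u) * ((Suc n choose (Suc n - u)) * (?b u * ?b (n - u))) =
        (Suc n choose Suc u) * (Suc n choose u) * (?b u * ?b (n - u))" by simp
  qed
  finally show ?thesis unfolding N_def .
qed

section \<open>Generating functions\<close>

unbundle fps_syntax

definition cnat_fps :: "rat fps" where
  "cnat_fps = Abs_fps (\<lambda>k. of_nat (num_complete_nat k) / (fact k * fact (Suc k)))"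

text \<open>This is the expansion of the Bessel function J_0(2 sqrt x).\<close>

definition bessel_fps :: "rat fps" where
  "bessel_fps = Abs_fps (\<lambda>j. (- 1) ^ j / (fact j)\<^sup>2)"

text \<open>Coefficient \<open>n\<close> of the left side is \<open>b_n / n!^2\<close>. Dividing the
  recurrence by \<open>(m+1)!^2\<close> distributes the factorials of the two binomials over the
  weights of \<open>cnat_fps\<close>, leaving a Cauchy product.\<close>

lemma cnat_fps_ode: "fps_deriv (fps_X * cnat_fps) = 1 + fps_X * cnat_fps\<^sup>2"
proof (rule fps_ext)
  fix n
  show "fps_deriv (fps_X * cnat_fps) $ n = (1 + fps_X * cnat_fps\<^sup>2) $ n"
  proof (cases n)
    case 0
    then show ?thesis by (simp add: cnat_fps_def num_complete_nat_0)
  next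
    case (Suc m)
    let ?b = "\<lambda>k. of_nat (num_complete_nat k) :: rat"
    have "of_nat (Suc m choose Suc u) * of_nat (Suc m choose u) * (?b u * ?b (m - u)) / (fact (Suc m))\<^sup>2 =
        cnat_fps $ u * cnat_fps $ (m - u)" if "u \<le> m" for u
    proof -
      have choose: "of_nat (Suc m choose Suc u) = (fact (Suc m) / (fact (Suc u) * fact (m - u)) :: rat)"
        "of_nat (Suc m choose u) = (fact (Suc m) / (fact u * fact (Suc (m - u))) :: rat)"
        using binomial_fact[of "Suc u" "Suc m"] binomial_fact[of u "Suc m"] that
        by (simp_all add: Suc_diff_le del: fact_Suc binomial_Suc_Suc)
      show ?thesis
        unfolding choose by (simp add: cnat_fps_def power2_eq_square del: fact_Suc)
    qed
    then have "?b (Suc m) / (fact (Suc m))\<^sup>2 = (\<Sum>u\<le>m. cnat_fps $ u * cnat_fps $ (m - u))"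
      unfolding num_complete_nat_Suc of_nat_sum sum_divide_distrib
      by (intro sum.cong refl) simp
    also have "\<dots> = (1 + fps_X * cnat_fps\<^sup>2) $ n"
      by (simp add: Suc) (simp add: power2_eq_square fps_mult_nth atLeast0AtMost)
    finally have "(1 + fps_X * cnat_fps\<^sup>2) $ n = ?b n / (fact n)\<^sup>2" unfolding Suc by simp
    moreover have "fps_deriv (fps_X * cnat_fps) $ n = ?b n / (fact n)\<^sup>2"
      by (simp add: cnat_fps_def power2_eq_square divide_simps del: of_nat_Suc) (simp add: algebra_simps)
    ultimately show ?thesis by simp
  qed
qed

lemma bessel_fps_ode: "fps_deriv (fps_X * fps_deriv bessel_fps) = - bessel_fps"
proof (rule fps_ext)
  fix n
  show "fps_deriv (fps_X * fps_deriv bessel_fps) $ n = (- bessel_fps) $ n"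
    by (simp add: bessel_fps_def power2_eq_square divide_simps del: of_nat_Suc) (simp add: algebra_simps)
qed

text \<open>The equation expresses \<open>Z $ Suc m\<close> through \<open>Z $ 0\<close>, ...,
  \<open>Z $ m\<close>, so all coefficients vanish in turn.\<close>

lemma fps_linear_ode_eq_0:
  fixes Z F :: "'a::field_char_0 fps"
  assumes "fps_deriv Z = F * Z" "Z $ 0 = 0"
  shows "Z = 0"
proof (rule fps_ext)
  fix n
  show "Z $ n = 0 $ n"
  proof (induction n rule: less_induct)
    case (less n)
    show ?case
    proof (cases n)
      case (Suc m)
      have "of_nat (Suc m) * Z $ Suc m = (F * Z) $ m"
        using assms(1) fps_deriv_nth[of Z m] by simp
      also have "\<dots> = 0" unfolding fps_mult_nth using less Suc by (intro sum.neutral) auto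
      finally show ?thesis using Suc of_nat_neq_0[of m] by (simp del: of_nat_Suc)
    qed (use assms(2) in simp)
  qed
qed

text \<open>The ODE for \<open>cnat_fps\<close> is the Riccati equation satisfied by \<open>- J' / J\<close>, where \<open>J\<close> is
  \<open>bessel_fps\<close>; instead of dividing, we check that the defect solves a homogeneous linear ODE.\<close>

lemma bessel_fps_mult_cnat_fps: "bessel_fps * cnat_fps = - fps_deriv bessel_fps"
proof -
  let ?J = bessel_fps and ?F = cnat_fps
  define H where "H = ?J * ?F + fps_deriv ?J"
  \<comment> \<open>The factor \<open>fps_X\<close> brings out the two products whose derivatives
    the ODEs evaluate, and makes the constant term vanish.\<close>
  have "fps_X * H = ?J * (fps_X * ?F) + fps_X * fps_deriv ?J"
    unfolding H_def by (simp add: algebra_simps)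
  then have "fps_deriv (fps_X * H) =
      fps_deriv ?J * (fps_X * ?F) + ?J * fps_deriv (fps_X * ?F) + fps_deriv (fps_X * fps_deriv ?J)"
    by (simp only: fps_deriv_add fps_deriv_mult) (simp add: algebra_simps)
  also have "\<dots> = ?F * (fps_X * H)"
    unfolding cnat_fps_ode bessel_fps_ode H_def by (simp add: algebra_simps power2_eq_square)
  finally have "fps_X * H = 0" by (rule fps_linear_ode_eq_0) simp
  then show ?thesis unfolding H_def by (simp add: eq_neg_iff_add_eq_0)
qed

text \<open>This is coefficient \<open>m\<close> of \<open>bessel_fps_mult_cnat_fps\<close>,
  multiplied by \<open>(- 1) ^ m\<close>.\<close>

lemma sum_num_complete_nat:
  "(\<Sum>k\<le>m. (- 1) ^ k * of_nat (num_complete_nat k) / (fact k * fact (Suc k) * (fact (m - k))\<^sup>2)) =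
    1 / (fact m * fact (Suc m) :: rat)"
proof -
  let ?b = "\<lambda>k. of_nat (num_complete_nat k) :: rat"
  have "(\<Sum>k\<le>m. (- 1) ^ k * ?b k / (fact k * fact (Suc k) * (fact (m - k))\<^sup>2)) =
      (- 1) ^ m * (\<Sum>k\<le>m. cnat_fps $ k * bessel_fps $ (m - k))"
    unfolding sum_distrib_left
  proof (intro sum.cong refl)
    fix k assume "k \<in> {..m}"
    then have "(- 1 :: rat) ^ m * (- 1) ^ (m - k) = (- 1) ^ k"
      by (simp add: minus_one_power_iff)
    then show "(- 1) ^ k * ?b k / (fact k * fact (Suc k) * (fact (m - k))\<^sup>2) =
        (- 1) ^ m * (cnat_fps $ k * bessel_fps $ (m - k))"
      by (simp add: cnat_fps_def bessel_fps_def divide_simps del: fact_Suc)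
  qed
  also have "(\<Sum>k\<le>m. cnat_fps $ k * bessel_fps $ (m - k)) = (- fps_deriv bessel_fps) $ m"
    unfolding bessel_fps_mult_cnat_fps[symmetric]
    by (subst mult.commute) (simp add: fps_mult_nth atLeast0AtMost)
  also have "(- 1) ^ m * \<dots> = 1 / (fact m * fact (Suc m))"
    by (simp add: bessel_fps_def power2_eq_square divide_simps del: of_nat_Suc)
  finally show ?thesis .
qed

section \<open>Finite differences of binomial coefficients\<close>

text \<open>Up to sign this is the \<open>N\<close>-th forward difference of
  \<open>M choose r\<close> in \<open>M\<close>. By Pascal's rule each difference lowers
  \<open>r\<close> by one, and beyond \<open>r\<close> steps the result is zero.\<close>

lemma alternating_sum_choose_mult_choose:
  "(\<Sum>j\<le>N. (- 1) ^ j * of_nat (N choose j) * of_nat ((M + j) choose r) :: 'a::comm_ring_1) =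
    (- 1) ^ N * (if N \<le> r then of_nat (M choose (r - N)) else 0)"
proof (induction N arbitrary: M)
  case 0
  then show ?case by simp
next
  case (Suc N)
  let ?D = "\<lambda>N M. \<Sum>j\<le>N. (- 1) ^ j * of_nat (N choose j) * of_nat ((M + j) choose r) :: 'a"
  have "?D (Suc N) M = of_nat (M choose r) +
      (\<Sum>j\<le>N. (- 1) ^ Suc j * of_nat (Suc N choose Suc j) * of_nat ((M + Suc j) choose r))"
    by (subst sum.atMost_Suc_shift) simp
  \<comment> \<open>Pascal's rule on \<open>Suc N choose Suc j\<close> separates the sum at
    \<open>M\<close> from the negated sum at \<open>Suc M\<close>.\<close>
  also have "\<dots> = (of_nat (M choose r) +
      (\<Sum>j\<le>N. (- 1) ^ Suc j * of_nat (N choose Suc j) * of_nat ((M + Suc j) choose r))) +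
      (\<Sum>j\<le>N. (- 1) ^ Suc j * of_nat (N choose j) * of_nat ((M + Suc j) choose r))"
    by (simp add: sum.distrib[symmetric] algebra_simps)
  also have "of_nat (M choose r) +
      (\<Sum>j\<le>N. (- 1) ^ Suc j * of_nat (N choose Suc j) * of_nat ((M + Suc j) choose r)) =
      (\<Sum>j\<le>Suc N. (- 1) ^ j * of_nat (N choose j) * of_nat ((M + j) choose r) :: 'a)"
    unfolding sum.atMost_Suc_shift by simp
  also have "\<dots> = ?D N M" by (simp add: binomial_eq_0)
  also have "(\<Sum>j\<le>N. (- 1) ^ Suc j * of_nat (N choose j) * of_nat ((M + Suc j) choose r)) = - ?D N (Suc M)"
    by (simp add: sum_negf)
  finally have "?D (Suc N) M = ?D N M - ?D N (Suc M)" by simp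
  then show ?case
  proof (cases "Suc N \<le> r")
    case True
    then have "r - N = Suc (r - Suc N)" by simp
    with Suc.IH[of M] Suc.IH[of "Suc M"] True \<open>?D (Suc N) M = ?D N M - ?D N (Suc M)\<close>
    show ?thesis by (simp add: algebra_simps)
  next
    case False
    with Suc.IH[of M] Suc.IH[of "Suc M"] \<open>?D (Suc N) M = ?D N M - ?D N (Suc M)\<close>
    show ?thesis by auto
  qed
qed

text \<open>The sum is, up to the factor \<open>1 / n\<close>, an \<open>n\<close>-th difference of
  a binomial coefficient with lower index \<open>n - 1\<close>, hence zero. For \<open>n = 0\<close>
  it would be 1.\<close>

lemma alternating_sum_fact_orthogonal:
  assumes "n \<ge> 1"
  shows "(\<Sum>m\<le>n. (- 1) ^ m * fact (n + m) / fact (n - m) * (1 / (fact m * fact (Suc m))) :: rat) = 0"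
proof -
  have "(- 1) ^ m * fact (n + m) / fact (n - m) * (1 / (fact m * fact (Suc m)) :: rat) =
      ((- 1) ^ m * of_nat (n choose m) * of_nat ((n + m) choose (n - 1))) / of_nat n" if "m \<le> n" for m
  proof -
    have "n + m - (n - 1) = Suc m" "fact n = of_nat n * (fact (n - 1) :: rat)"
      using assms by (auto simp: fact_reduce)
    then show ?thesis using that assms
      by (simp add: binomial_fact divide_simps del: fact_Suc)
  qed
  then have "(\<Sum>m\<le>n. (- 1) ^ m * fact (n + m) / fact (n - m) * (1 / (fact m * fact (Suc m))) :: rat) =
      (\<Sum>m\<le>n. (- 1) ^ m * of_nat (n choose m) * of_nat ((n + m) choose (n - 1))) / of_nat n"
    unfolding sum_divide_distrib by (intro sum.cong refl) simp
  also have "\<dots> = 0" using assms by (subst alternating_sum_choose_mult_choose) auto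
  finally show ?thesis .
qed

text \<open>With \<open>m = j + k\<close> the sum becomes an \<open>N\<close>-th difference of
  \<open>(M + j) choose M\<close>, which leaves \<open>M choose N\<close>. The second such factor
  comes from the prefactor \<open>M! / N! = (2k)! (M choose N)\<close>, as
  \<open>M - N = 2k\<close>.\<close>

lemma alternating_sum_fact_shift:
  assumes "k \<le> n"
  shows "(\<Sum>m\<in>{k..n}. (- 1) ^ m * fact (n + m) / fact (n - m) / (fact (m - k))\<^sup>2 :: rat) =
    (- 1) ^ n * (fact (2 * k) * (of_nat ((n + k) choose (n - k)))\<^sup>2)"
proof -
  define N M where "N = n - k" and "M = n + k"
  have nk: "n = N + k" "M = N + 2 * k" using assms unfolding N_def M_def by auto
  have "(\<Sum>m\<in>{k..n}. (- 1) ^ m * fact (n + m) / fact (n - m) / (fact (m - k))\<^sup>2 :: rat) =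
      (\<Sum>j\<le>N. (- 1) ^ (j + k) * fact (n + (j + k)) / fact (n - (j + k)) / (fact j)\<^sup>2)"
    by (rule sum.reindex_bij_witness[of _ "\<lambda>j. j + k" "\<lambda>m. m - k"]) (auto simp: nk)
  also have "\<dots> = (\<Sum>j\<le>N. (- 1) ^ k * (fact M / fact N) *
      ((- 1) ^ j * of_nat (N choose j) * of_nat ((M + j) choose M)))"
  proof (intro sum.cong refl)
    fix j assume "j \<in> {..N}"
    have eqs: "n + (j + k) = M + j" "n - (j + k) = N - j" by (auto simp: nk)
    show "(- 1) ^ (j + k) * fact (n + (j + k)) / fact (n - (j + k)) / (fact j)\<^sup>2 =
        (- 1) ^ k * (fact M / fact N) *
        ((- 1) ^ j * of_nat (N choose j) * of_nat ((M + j) choose M) :: rat)"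
      using \<open>j \<in> {..N}\<close> unfolding eqs
      by (simp add: binomial_fact power_add power2_eq_square mult_ac)
  qed
  also have "\<dots> = (- 1) ^ k * (fact M / fact N) * ((- 1) ^ N * of_nat (M choose (M - N)))"
    unfolding sum_distrib_left[symmetric] alternating_sum_choose_mult_choose by (simp add: nk)
  also have "\<dots> = (- 1) ^ n * (fact (2 * k) * (of_nat (M choose N))\<^sup>2)"
    by (simp add: nk binomial_fact power_add power2_eq_square mult_ac)
  finally show ?thesis unfolding N_def M_def .
qed

text \<open>In this form the denominator is the weight of \<open>cnat_fps\<close>, and the numerator
  is the factor \<open>fact (2 * k)\<close> of \<open>alternating_sum_fact_shift\<close>.\<close>

lemma catalan_eq_fact: "catalan k = fact (2 * k) / (fact k * fact (Suc k))"
  unfolding catalan_def by (simp add: binomial_fact del: of_nat_Suc)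

theorem corollary13:
  fixes n :: nat
  assumes "n \<ge> 1"
  shows "(\<Sum>k=0..n. (- 1) ^ k * of_nat (num_complete_nat k) * catalan k
            * of_nat ((n + k) choose (n - k)) ^ 2) = 0"
proof -
  \<comment> \<open>\<open>a k\<close> is the signed coefficient of \<open>cnat_fps\<close>, and
    \<open>c m\<close> below is the weight given to the \<open>m\<close>-th linear relation.\<close>
  define a :: "nat \<Rightarrow> rat" where
    "a k = (- 1) ^ k * of_nat (num_complete_nat k) / (fact k * fact (Suc k))" for k
  define c :: "nat \<Rightarrow> rat" where "c m = (- 1) ^ m * fact (n + m) / fact (n - m)" for m
  \<comment> \<open>The factor \<open>(- 1) ^ n\<close> matches the sign in
    \<open>alternating_sum_fact_shift\<close>; it is nonzero and cancels at the end.\<close>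
  have "(- 1) ^ n * (\<Sum>k=0..n. (- 1) ^ k * of_nat (num_complete_nat k) * catalan k
      * of_nat ((n + k) choose (n - k)) ^ 2) =
      (\<Sum>k\<le>n. a k * ((- 1) ^ n * (fact (2 * k) * (of_nat ((n + k) choose (n - k)))\<^sup>2)))"
    unfolding sum_distrib_left atLeast0AtMost
    by (intro sum.cong refl) (simp add: a_def catalan_eq_fact)
  also have "\<dots> = (\<Sum>k\<le>n. \<Sum>m\<in>{k..n}. a k * (c m / (fact (m - k))\<^sup>2))"
    by (intro sum.cong refl)
      (simp add: alternating_sum_fact_shift[symmetric] sum_distrib_left c_def)
  \<comment> \<open>Summing over the triangle \<open>k \<le> m \<le> n\<close> in the other order
    makes the inner sum the left side of \<open>sum_num_complete_nat\<close>.\<close>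
  also have "\<dots> = (\<Sum>m\<le>n. \<Sum>k\<le>m. a k * (c m / (fact (m - k))\<^sup>2))"
    unfolding sum.Sigma[OF finite_atMost ballI[OF finite_atLeastAtMost]]
      sum.Sigma[OF finite_atMost ballI[OF finite_atMost]]
    by (rule sum.reindex_bij_witness[of _ "\<lambda>(m, k). (k, m)" "\<lambda>(k, m). (m, k)"]) auto
  also have "\<dots> = (\<Sum>m\<le>n. c m * (\<Sum>k\<le>m. a k / (fact (m - k))\<^sup>2))"
    unfolding sum_distrib_left by (intro sum.cong refl) simp
  also have "\<dots> = (\<Sum>m\<le>n. c m * (1 / (fact m * fact (Suc m))))"
    unfolding a_def by (simp only: sum_num_complete_nat divide_divide_eq_left)
  also have "\<dots> = 0"
    using alternating_sum_fact_orthogonal[OF assms] unfolding c_def .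
  finally show ?thesis by simp
qed

end
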